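(* Let $P$ be a Rota-Baxter operator of weight $\lambda$ on an associative algebra $\mathcal A$. Define the bracket $$[x,y]_P:=[P(x),y]+[x,P(y)]+\lambda[x,y],\qquad x,y\in\mathcal A.$$ Then $(\mathcal A,[\cdot,\cdot]_P)$ is a Lie algebra.
   Context: $\mathcal A$ is an associative algebra over a field $\mathbb{K}$, $\lambda\in\mathbb{K}$, and $[x,y]=xy-yx$ is the commutator. A Rota-Baxter operator of weight $\lambda$ on $\mathcal A$ is a linear map $P:\mathcal A\to\mathcal A$ with $P(x)P(y)=P(xP(y))+P(P(x)y)+\lambda P(xy)$ for all $x,y\in\mathcal A$. A Lie algebra structure means a bilinear antisymmetric bracket satisfying the Jacobi identity. *)

theory Defs
  imports Complex_Main
begin

text \<open>
  The class \<open>ring\<close> has an associative, bi-additive multiplication, not necessarily commutative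
  and not required to have a unit.
\<close>

locale assoc_algebra = vector_space scale
  for scale :: "'k::field \<Rightarrow> 'a::ring \<Rightarrow> 'a"  (infixr \<open>*s\<close> 75) +
  assumes scale_mult_left: "(c *s x) * y = c *s (x * y)"
    and scale_mult_right: "x * (c *s y) = c *s (x * y)"

definition commutator :: "'a::ring \<Rightarrow> 'a \<Rightarrow> 'a" where
  "commutator x y = x * y - y * x"

locale rota_baxter_operator = assoc_algebra scale + Vector_Spaces.linear scale scale P
  for scale :: "'k::field \<Rightarrow> 'a::ring \<Rightarrow> 'a"  (infixr \<open>*s\<close> 75)
    and weight :: 'k
    and P :: "'a \<Rightarrow> 'a" +
  assumes rota_baxter: "P x * P y = P (x * P y) + P (P x * y) + weight *s P (x * y)"

definition rb_bracket ::
    "('k::field \<Rightarrow> 'a::ring \<Rightarrow> 'a) \<Rightarrow> 'k \<Rightarrow> ('a \<Rightarrow> 'a) \<Rightarrow> 'a \<Rightarrow> 'a \<Rightarrow> 'a" where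
  "rb_bracket scale weight P x y =
     commutator (P x) y + commutator x (P y) + scale weight (commutator x y)"

text \<open>
  A Lie bracket is required to be antisymmetric; in characteristic 2 this is weaker than the
  alternating law \<open>bracket x x = 0\<close>.
\<close>

locale lie_algebra = vector_space scale
  for scale :: "'k::field \<Rightarrow> 'a::ab_group_add \<Rightarrow> 'a"
    and bracket :: "'a \<Rightarrow> 'a \<Rightarrow> 'a" +
  assumes linear_left: "Vector_Spaces.linear scale scale (\<lambda>x. bracket x y)"
    and linear_right: "Vector_Spaces.linear scale scale (\<lambda>y. bracket x y)"
    and antisymmetric: "bracket x y = - bracket y x"
    and jacobi: "bracket x (bracket y z) + bracket y (bracket z x) + bracket z (bracket x y) = 0"

end

theory Submission
  imports Defs
begin

text \<open>
  A Rota-Baxter operator \<open>P\<close> of weight \<open>\<lambda>\<close> turns the algebra into a second associative algebra,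
  with the \<^emph>\<open>double product\<close> \<open>x \<star> y = P x * y + x * P y + \<lambda> x * y\<close>. The bracket in question is
  the commutator of \<open>\<star>\<close>, so the Jacobi identity needs no computation with \<open>P\<close> beyond the
  associativity of \<open>\<star>\<close>: the commutator of any bilinear associative product is a Lie bracket.

  The Rota-Baxter identity says exactly that \<open>P (x \<star> y) = P x * P y\<close>. Using this, both
  bracketings of \<open>x \<star> y \<star> z\<close> expand to the sum of the products of three factors in which at least
  one factor is left bare and every other one carries \<open>P\<close>, where a product with \<open>k\<close> bare factors
  has the coefficient \<open>\<lambda> ^ (k - 1)\<close>. That sum does not depend on the bracketing.
\<close>

text \<open>
  Each of the six orders of \<open>x\<close>, \<open>y\<close>, \<open>z\<close> occurs in the Jacobi sum twice, with opposite signs and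
  with different bracketings; associativity makes these two terms cancel. The product \<open>m\<close> is a parameter because it is
  to be a new product on a type that already has a multiplication.
\<close>

lemma lie_algebra_commutator_of_associative:
  fixes scale :: "'k::field \<Rightarrow> 'a::ab_group_add \<Rightarrow> 'a"
    and m :: "'a \<Rightarrow> 'a \<Rightarrow> 'a"
  assumes lin_left: "\<And>y. Vector_Spaces.linear scale scale (\<lambda>x. m x y)"
    and lin_right: "\<And>x. Vector_Spaces.linear scale scale (m x)"
    and assoc: "\<And>x y z. m (m x y) z = m x (m y z)"
  shows "lie_algebra scale (\<lambda>x y. m x y - m y x)"
proof -
  interpret vector_space scale
    using lin_right[of 0] by (simp add: Vector_Spaces.linear_iff)
  interpret vector_space_pair scale scale ..
  have diff_left: "m (x - y) z = m x z - m y z" for x y z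
    using linear_diff[OF lin_left] .
  have diff_right: "m x (y - z) = m x y - m x z" for x y z
    using linear_diff[OF lin_right] .
  show ?thesis
  proof (intro lie_algebra.intro lie_algebra_axioms.intro)
    show "vector_space scale"
      by (rule vector_space_axioms)
    show "Vector_Spaces.linear scale scale (\<lambda>x. m x y - m y x)" for y
      by (rule linear_compose_sub[OF lin_left lin_right])
    show "Vector_Spaces.linear scale scale (\<lambda>y. m x y - m y x)" for x
      by (rule linear_compose_sub[OF lin_right lin_left])
    show "m x y - m y x = - (m y x - m x y)" for x y
      by simp
    show "m x (m y z - m z y) - m (m y z - m z y) x
        + (m y (m z x - m x z) - m (m z x - m x z) y)
        + (m z (m x y - m y x) - m (m x y - m y x) z) = 0" for x y z
      by (simp add: diff_left diff_right assoc)
  qed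
qed

definition double_product ::
    "('k::field \<Rightarrow> 'a::ring \<Rightarrow> 'a) \<Rightarrow> 'k \<Rightarrow> ('a \<Rightarrow> 'a) \<Rightarrow> 'a \<Rightarrow> 'a \<Rightarrow> 'a" where
  "double_product scale weight P x y = P x * y + x * P y + scale weight (x * y)"

context rota_baxter_operator
begin

abbreviation star :: "'a \<Rightarrow> 'a \<Rightarrow> 'a"  (infixl \<open>\<star>\<close> 70) where
  "x \<star> y \<equiv> double_product scale weight P x y"

lemma linear_double_product_left: "Vector_Spaces.linear scale scale (\<lambda>x. x \<star> y)"
  by (simp add: Vector_Spaces.linear_iff vector_space_axioms double_product_def add scale
      algebra_simps scale_mult_left scale_mult_right scale_right_distrib mult.commute[of weight])

lemma linear_double_product_right: "Vector_Spaces.linear scale scale (\<lambda>y. x \<star> y)"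
  by (simp add: Vector_Spaces.linear_iff vector_space_axioms double_product_def add scale
      algebra_simps scale_mult_left scale_mult_right scale_right_distrib mult.commute[of weight])

text \<open>
  This is the Rota-Baxter identity read from right to left: \<open>P\<close> is a homomorphism from the double
  product to the original one.
\<close>

lemma map_double_product: "P (x \<star> y) = P x * P y"
  by (simp add: double_product_def add scale rota_baxter add.commute)

text \<open>
  On either side the outer product applies \<open>P\<close> to the whole inner product, where the homomorphism
  property applies; no nested \<open>P\<close> survives, and bilinearity of the original product does the rest.
\<close>

lemma double_product_assoc: "(x \<star> y) \<star> z = x \<star> (y \<star> z)"
proof -
  have "(x \<star> y) \<star> z = P x * P y * z + (x \<star> y) * P z + weight *s ((x \<star> y) * z)"
    by (simp only: double_product_def[of scale weight P "x \<star> y"] map_double_product)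
  also have "\<dots> = P x * (y \<star> z) + x * (P y * P z) + weight *s (x * (y \<star> z))"
    by (simp add: double_product_def algebra_simps scale_mult_left scale_mult_right
        scale_right_distrib)
  also have "\<dots> = x \<star> (y \<star> z)"
    by (simp only: double_product_def[of scale weight P x "y \<star> z"] map_double_product)
  finally show ?thesis .
qed

lemma rb_bracket_eq_commutator: "rb_bracket scale weight P x y = x \<star> y - y \<star> x"
  by (simp add: rb_bracket_def commutator_def double_product_def scale_right_diff_distrib)

end

theorem lemma3p2:
  fixes scale :: "'k::field \<Rightarrow> 'a::ring \<Rightarrow> 'a"
    and weight :: 'k
    and P :: "'a \<Rightarrow> 'a"
  assumes "rota_baxter_operator scale weight P"
  shows "lie_algebra scale (rb_bracket scale weight P)"
proof -
  interpret rota_baxter_operator scale weight P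
    by (rule assms)
  have "rb_bracket scale weight P = (\<lambda>x y. x \<star> y - y \<star> x)"
    by (intro ext rb_bracket_eq_commutator)
  then show ?thesis
    using lie_algebra_commutator_of_associative[OF linear_double_product_left
        linear_double_product_right double_product_assoc]
    by simp
qed

end
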